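(* Let $X=\{x_1,\dots,x_n\}\subset\mathbb{R}^p$ be in general position about $t$, let $n>p(p-1)$, and let $u$ satisfy the conditions listed in the context, with $K=\sup_{s>0}su(s)>p$. Fix $m\ge1$, put $\epsilon_m=m/(n+m)$, and let $\theta\in\mathbb{R}^p$ with $\theta'\theta=1$. For $r\in\mathbb{R}$ let $y_r=r\theta+t$, let $Y_r=\{y_r,y_r,\dots,y_r\}$ ($m$ copies), and let $Z_r=X\cup Y_r$. If $n+1>K$ and $$\min(1/K,\,1-p/K)<\epsilon_m<\min(p/K,\,1-p/K),$$ then $\theta'V_{n+m}^{-1}(Z_r)\theta\to0$ as $|r|\to\infty$, and if $a\in\mathbb{R}^p$ is not proportional to $\theta$, then $\inf_r a'V_{n+m}^{-1}(Z_r)a>0$.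
   Context: Fix a dimension $p$, a center $t\in\mathbb{R}^p$ and a function $u:[0,\infty)\to\mathbb{R}$. Put $\psi(s)=su(s)$ and $K=\sup_{s>0}\psi(s)$. Conditions on $u$: (i) $u(s)$ is non-negative, non-increasing and continuous for $s>0$; (ii) $u(s)$ and $su(s)$ are bounded; (iii) $\psi$ is non-decreasing on $s>0$ and strictly increasing on $\{s>0:\psi(s)<K\}$; (iv) $K>p$. For a finite collection (multiset) $Z=\{z_1,\dots,z_N\}$ of points of $\mathbb{R}^p$, the $M$-estimate of scatter $V_N(Z)$ about $t$ is a symmetric positive definite matrix $V$ satisfying $$V=\frac1N\sum_{i=1}^N u(s_i)(z_i-t)(z_i-t)',\qquad s_i=(z_i-t)'V^{-1}(z_i-t).$$ $V_N^{-1}(Z)$ denotes its inverse. $X$ is in general position about $t$ if for every $p$ of the points, the vectors $x_i-t$ span $\mathbb{R}^p$. Unions of collections are multiset unions, so $Z_r$ has $n+m$ points. Under the stated hypotheses $V_{n+m}(Z_r)$ exists and is unique for every $r$. "Proportional to $\theta$" means equal to $c\theta$ for some $c\in\mathbb{R}$ (including $c=0$). *)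

theory Defs
  imports "HOL-Analysis.Analysis" "HOL-Library.Multiset"
begin

definition psi :: "(real \<Rightarrow> real) \<Rightarrow> real \<Rightarrow> real" where
  "psi u s = s * u s"

definition psi_sup :: "(real \<Rightarrow> real) \<Rightarrow> real" where
  "psi_sup u = (SUP s\<in>{0<..}. psi u s)"

text \<open>Conditions (i)--(iii) on the weight function. The paper's functions live on the half-line
  $[0,\infty)$; values of \<open>u\<close> at negative arguments are never used, because squared distances
  with respect to a positive definite matrix are non-negative.\<close>

definition scatter_weight :: "(real \<Rightarrow> real) \<Rightarrow> bool" where
  "scatter_weight u \<longleftrightarrow>
     (\<forall>s>0. 0 \<le> u s) \<and> antimono_on {0<..} u \<and> continuous_on {0<..} u \<and>
     bounded (u ` {0..}) \<and> bounded (psi u ` {0..}) \<and>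
     mono_on {0<..} (psi u) \<and> strict_mono_on {s. 0 < s \<and> psi u s < psi_sup u} (psi u)"

definition sym_pos_def :: "real ^ 'p ^ 'p \<Rightarrow> bool" where
  "sym_pos_def V \<longleftrightarrow> transpose V = V \<and> (\<forall>v. v \<noteq> 0 \<longrightarrow> 0 < v \<bullet> (V *v v))"

definition outer :: "real ^ 'p \<Rightarrow> real ^ 'p ^ 'p" where
  "outer v = (\<chi> i j. v $ i * v $ j)"

definition sq_dist :: "real ^ 'p \<Rightarrow> real ^ 'p ^ 'p \<Rightarrow> real ^ 'p \<Rightarrow> real" where
  "sq_dist t V z = (z - t) \<bullet> (matrix_inv V *v (z - t))"

definition is_M_scatter ::
  "(real \<Rightarrow> real) \<Rightarrow> real ^ 'p \<Rightarrow> (real ^ 'p) multiset \<Rightarrow> real ^ 'p ^ 'p \<Rightarrow> bool" where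
  "is_M_scatter u t Z V \<longleftrightarrow> sym_pos_def V \<and>
     V = (1 / real (size Z)) *\<^sub>R (\<Sum>z\<in>#Z. u (sq_dist t V z) *\<^sub>R outer (z - t))"

text \<open>A definite description: statements about \<open>M_scatter u t Z\<close> carry content only where the
  defining equation has exactly one symmetric positive definite solution.\<close>

definition M_scatter ::
  "(real \<Rightarrow> real) \<Rightarrow> real ^ 'p \<Rightarrow> (real ^ 'p) multiset \<Rightarrow> real ^ 'p ^ 'p" where
  "M_scatter u t Z = (THE V. is_M_scatter u t Z V)"

text \<open>Sub-multisets range over choices of \<open>p\<close> of the points counted with multiplicity; in
  particular (for at least \<open>p\<close> points and \<open>p > 1\<close>) no point of \<open>X\<close> is repeated.\<close>

definition general_position_about :: "real ^ 'p \<Rightarrow> (real ^ 'p) multiset \<Rightarrow> bool" where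
  "general_position_about t X \<longleftrightarrow>
     (\<forall>Y. Y \<subseteq># X \<and> size Y = CARD('p) \<longrightarrow> span ((\<lambda>x. x - t) ` set_mset Y) = UNIV)"

definition contaminated ::
  "real ^ 'p \<Rightarrow> (real ^ 'p) multiset \<Rightarrow> nat \<Rightarrow> real ^ 'p \<Rightarrow> real \<Rightarrow> (real ^ 'p) multiset" where
  "contaminated t X m \<theta> r = X + replicate_mset m (r *\<^sub>R \<theta> + t)"

end

(* Let V be the estimate for Z_r, tau = theta' V^-1 theta and s = r^2 tau the squared distance of
   the contaminating point. Evaluating the defining equation at g = V^-1 theta and dropping the
   contribution of X gives tau >= eps psi(s) tau, so psi(s) <= 1/eps < K; hence s stays bounded and
   tau = s / r^2 tends to 0. For a not proportional to theta take b orthogonal to theta with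
   a'b > 0: then b'Vb does not see the contaminating point, so it is bounded uniformly in r, and
   (a'b)^2 <= (a' V^-1 a)(b'Vb).

   It remains to see that V exists and is unique. This holds whenever every proper subspace H
   carries a fraction less than 1 - (p - dim H)/K of the points, which general position guarantees
   here. For existence one iterates the monotone map whose fixed points are the estimates,
   downwards from a large multiple of the identity; if the limit had a proper range H, taking
   traces would give dim H + K * (fraction off H) <= p. For uniqueness, if B had maximal ratio
   l > 1 relative to A, then every point would lie in A L or be orthogonal to L, where
   L = {v. B v = l A v}, and taking the trace on L contradicts the condition on the orthogonal
   complement of L. *)
theory Submission
  imports Defs
begin

subsection \<open>Positive definite forms\<close>

lemma sym_inner:
  fixes A :: "real^'p^'p"
  assumes "transpose A = A"
  shows "x \<bullet> (A *v y) = (A *v x) \<bullet> y"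
proof -
  have "x \<bullet> (A *v y) = (transpose A *v x) \<bullet> y"
    unfolding transpose_matrix_vector by (rule dot_lmul_matrix[symmetric])
  then show ?thesis unfolding assms .
qed

lemma sym_matrix_eq:
  fixes A B :: "real^'p^'p"
  assumes "transpose A = A" "transpose B = B" and eq: "\<And>v. v \<bullet> (A *v v) = v \<bullet> (B *v v)"
  shows "A = B"
proof -
  have xy: "x \<bullet> (A *v y) = x \<bullet> (B *v y)" for x y
    using eq[of "x + y"] eq[of x] eq[of y] sym_inner[OF assms(1), of x y] sym_inner[OF assms(2), of x y]
    by (simp add: matrix_vector_right_distrib inner_add inner_commute)
  have "A *v y = B *v y" for y
    using xy vector_eq_ldot[of "A *v y" "B *v y"] by blast
  then show ?thesis
    by (simp add: matrix_eq)
qed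

text \<open>Moving from \<open>v\<close> a small step against \<open>w = D v\<close> changes the
  form by \<open>-2 e |w|^2\<close> to first order, so a nonzero \<open>w\<close> would make it
  negative.\<close>

lemma psd_kernel:
  fixes D :: "real^'p^'p"
  assumes sym: "transpose D = D" and psd: "\<And>v. 0 \<le> v \<bullet> (D *v v)" and zero: "v \<bullet> (D *v v) = 0"
  shows "D *v v = 0"
proof (rule ccontr)
  assume nz: "D *v v \<noteq> 0"
  define w where "w = D *v v"
  \<comment> \<open>This step length keeps \<open>e * (w \<bullet> (D *v w))\<close> at most
    \<open>w \<bullet> w\<close>; the added 1 covers a vanishing form at \<open>w\<close>.\<close>
  define e where "e = (w \<bullet> w) / (w \<bullet> (D *v w) + 1)"
  have w: "0 < w \<bullet> w" using nz by (simp add: w_def)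
  have dw: "0 \<le> w \<bullet> (D *v w)" by (rule psd)
  have e: "0 < e" using w dw by (simp add: e_def)
  have "0 \<le> (v - e *\<^sub>R w) \<bullet> (D *v (v - e *\<^sub>R w))" by (rule psd)
  also have "\<dots> = - 2 * e * (w \<bullet> w) + e * e * (w \<bullet> (D *v w))"
    using zero sym_inner[OF sym, of v w]
    by (simp add: matrix_vector_mult_diff_distrib matrix_vector_mult_scaleR inner_diff algebra_simps
        flip: w_def)
  finally have "2 * (w \<bullet> w) \<le> e * (w \<bullet> (D *v w))"
    using e mult_le_cancel_left_pos[OF e, of "2 * (w \<bullet> w)" "e * (w \<bullet> (D *v w))"] by (simp add: algebra_simps)
  also have "\<dots> \<le> w \<bullet> w"
    using w dw by (simp add: e_def field_simps)
  finally show False using w by simp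
qed

lemma sym_pos_def_invertible:
  assumes "sym_pos_def A" shows "invertible A"
  unfolding invertible_left_inverse matrix_left_invertible_ker
proof (intro allI impI)
  fix v assume "A *v v = 0"
  then have "\<not> 0 < v \<bullet> (A *v v)" by simp
  then show "v = 0" using assms unfolding sym_pos_def_def by blast
qed

lemma matrix_inv_mult:
  fixes A :: "real^'p^'p"
  assumes "invertible A"
  shows "A ** matrix_inv A = mat 1" "matrix_inv A ** A = mat 1"
proof -
  have "A ** matrix_inv A = mat 1 \<and> matrix_inv A ** A = mat 1"
    unfolding matrix_inv_def by (rule someI_ex[OF assms[unfolded invertible_def]])
  then show "A ** matrix_inv A = mat 1" "matrix_inv A ** A = mat 1" by blast+
qed

context
  fixes A :: "real^'p^'p"
  assumes pd: "sym_pos_def A"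
begin

lemma pd_mult_inv: "A *v (matrix_inv A *v x) = x"
  by (simp add: matrix_vector_mul_assoc matrix_inv_mult pd sym_pos_def_invertible)

lemma pd_inv_mult: "matrix_inv A *v (A *v x) = x"
  by (simp add: matrix_vector_mul_assoc matrix_inv_mult pd sym_pos_def_invertible)

lemma pd_sym: "x \<bullet> (A *v y) = (A *v x) \<bullet> y"
  using pd by (auto simp: sym_pos_def_def intro: sym_inner)

lemma pd_pos: "v \<noteq> 0 \<Longrightarrow> 0 < v \<bullet> (A *v v)"
  using pd by (auto simp: sym_pos_def_def)

lemma pd_nonneg: "0 \<le> v \<bullet> (A *v v)"
  using pd_pos[of v] by (cases "v = 0") auto

lemma pd_inv_pos:
  assumes "v \<noteq> 0" shows "0 < v \<bullet> (matrix_inv A *v v)"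
proof -
  have "matrix_inv A *v v \<noteq> 0" using pd_mult_inv[of v] assms by auto
  from pd_pos[OF this] show ?thesis by (simp add: pd_mult_inv inner_commute)
qed

lemma pd_inv_nonneg: "0 \<le> v \<bullet> (matrix_inv A *v v)"
  using pd_inv_pos[of v] by (cases "v = 0") auto

text \<open>Nonnegativity of the \<open>A\<close>-form at \<open>b\<close> minus its
  \<open>A\<close>-orthogonal projection onto \<open>matrix_inv A *v x\<close>.\<close>

lemma pd_Cauchy_Schwarz: "(b \<bullet> x)\<^sup>2 \<le> (x \<bullet> (matrix_inv A *v x)) * (b \<bullet> (A *v b))"
proof (cases "x = 0")
  case False
  define g where "g = matrix_inv A *v x"
  define s where "s = x \<bullet> g"
  have s: "0 < s" unfolding s_def g_def using False by (rule pd_inv_pos)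
  have Ag: "A *v g = x" by (simp add: g_def pd_mult_inv)
  define e where "e = (b \<bullet> x) / s"
  have "0 \<le> (b - e *\<^sub>R g) \<bullet> (A *v (b - e *\<^sub>R g))" by (rule pd_nonneg)
  also have "\<dots> = b \<bullet> (A *v b) - 2 * e * (b \<bullet> x) + e * e * s"
    using pd_sym[of g b]
    by (simp add: matrix_vector_mult_diff_distrib matrix_vector_mult_scaleR inner_diff algebra_simps
        Ag s_def inner_commute)
  also have "\<dots> = b \<bullet> (A *v b) - (b \<bullet> x)\<^sup>2 / s"
    using s by (simp add: e_def power2_eq_square)
  finally show ?thesis
    using s by (simp add: field_simps flip: s_def g_def)
qed simp

text \<open>Legendre duality: the inverse form is the maximum over \<open>h\<close> of the left
  side, and the difference is the \<open>A\<close>-form at \<open>A^-1 x - h\<close>. Inverses can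
  so be compared through trial vectors.\<close>

lemma pd_dual_le: "2 * (h \<bullet> x) - h \<bullet> (A *v h) \<le> x \<bullet> (matrix_inv A *v x)"
proof -
  define g where "g = matrix_inv A *v x"
  have Ag: "A *v g = x" by (simp add: g_def pd_mult_inv)
  have "0 \<le> (g - h) \<bullet> (A *v (g - h))" by (rule pd_nonneg)
  then show ?thesis
    using pd_sym[of g h] by (simp add: matrix_vector_mult_diff_distrib inner_diff Ag inner_commute flip: g_def)
qed

text \<open>The maximizer is unique because the gap is a definite form. Uniqueness of the estimate
  turns on this equality case.\<close>

lemma pd_dual_eq:
  assumes "2 * (h \<bullet> x) - h \<bullet> (A *v h) \<ge> x \<bullet> (matrix_inv A *v x)"
  shows "A *v h = x"
proof -
  define g where "g = matrix_inv A *v x"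
  have Ag: "A *v g = x" by (simp add: g_def pd_mult_inv)
  have "(g - h) \<bullet> (A *v (g - h)) \<le> 0"
    using assms pd_sym[of g h] 
    by (simp add: matrix_vector_mult_diff_distrib inner_diff Ag inner_commute flip: g_def)
  then have "g - h = 0" using pd_pos[of "g - h"] by fastforce
  with Ag show ?thesis by simp
qed

end

section \<open>The Loewner order and limits of decreasing forms\<close>

definition form_le :: "real^'p^'p \<Rightarrow> real^'p^'p \<Rightarrow> bool" where
  "form_le A B \<longleftrightarrow> (\<forall>v. v \<bullet> (A *v v) \<le> v \<bullet> (B *v v))"

text \<open>The maximizer for \<open>B\<close> serves as trial vector in the dual bound for
  \<open>A\<close>.\<close>

lemma form_le_inv:
  fixes A B :: "real^'p^'p"
  assumes "sym_pos_def A" "sym_pos_def B" "form_le A B"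
  shows "x \<bullet> (matrix_inv B *v x) \<le> x \<bullet> (matrix_inv A *v x)"
proof -
  define h where "h = matrix_inv B *v x"
  have "B *v h = x" by (simp add: h_def pd_mult_inv assms)
  then have "2 * (h \<bullet> x) - h \<bullet> (A *v h) \<ge> h \<bullet> x"
    using assms(3) by (auto simp: form_le_def inner_commute dest: spec[of _ h])
  with pd_dual_le[OF assms(1), of h x] show ?thesis by (simp add: h_def inner_commute)
qed

lemma form_le_antisym:
  "sym_pos_def A \<Longrightarrow> sym_pos_def B \<Longrightarrow> form_le A B \<Longrightarrow> form_le B A \<Longrightarrow> A = B"
  by (rule sym_matrix_eq) (simp_all add: form_le_def sym_pos_def_def antisym)

text \<open>The values of the forms decrease and are bounded below by 0; polarization then yields
  the entries of the limit. The limit may be singular, which the existence proof has to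
  exclude.\<close>

lemma decreasing_forms_converge:
  fixes V :: "nat \<Rightarrow> real^'p^'p"
  assumes sym: "\<And>k. transpose (V k) = V k" and psd: "\<And>k v. 0 \<le> v \<bullet> (V k *v v)"
    and dec: "\<And>k. form_le (V (Suc k)) (V k)"
  obtains L where "transpose L = L" "\<And>v. 0 \<le> v \<bullet> (L *v v)" "\<And>k. form_le L (V k)"
    "\<And>w. (\<lambda>k. V k *v w) \<longlonglongrightarrow> L *v w"
proof -
  have dec': "decseq (\<lambda>k. v \<bullet> (V k *v v))" for v
    using dec by (auto simp: decseq_Suc_iff form_le_def)
  obtain q where q: "\<And>v. (\<lambda>k. v \<bullet> (V k *v v)) \<longlonglongrightarrow> q v" and ql: "\<And>k v. q v \<le> v \<bullet> (V k *v v)"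
  proof -
    have "\<exists>q. (\<lambda>k. v \<bullet> (V k *v v)) \<longlonglongrightarrow> q \<and> (\<forall>k. q \<le> v \<bullet> (V k *v v))" for v
      by (rule decseq_convergent[OF dec'[of v], of 0]) (use psd in auto)
    then show ?thesis using that by metis
  qed
  define L :: "real^'p^'p" where
    "L = (\<chi> i j. (q (axis i 1 + axis j 1) - q (axis i 1) - q (axis j 1)) / 2)"
  have entry: "V k $ i $ j = ((axis i 1 + axis j 1) \<bullet> (V k *v (axis i 1 + axis j 1))
      - axis i 1 \<bullet> (V k *v axis i 1) - axis j 1 \<bullet> (V k *v axis j 1)) / 2" for k i j
  proof -
    have "V k $ i $ j = axis i 1 \<bullet> (V k *v axis j 1)"
      by (simp add: inner_axis' matrix_vector_mul_component inner_axis)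
    then show ?thesis
      using sym_inner[OF sym, of "axis i 1" k "axis j 1"]
      by (simp add: matrix_vector_right_distrib inner_add inner_commute)
  qed
  have lim: "(\<lambda>k. V k $ i $ j) \<longlonglongrightarrow> L $ i $ j" for i j
    unfolding entry L_def by (auto intro!: tendsto_intros q)
  have limv: "(\<lambda>k. V k *v w) \<longlonglongrightarrow> L *v w" for w
    unfolding matrix_vector_mult_def by (intro tendsto_intros lim)
  have qL: "q v = v \<bullet> (L *v v)" for v
    using LIMSEQ_unique[OF q[of v] tendsto_inner[OF tendsto_const limv]] .
  have "transpose L = L"
    by (simp add: L_def transpose_def vec_eq_iff add.commute)
  moreover have "0 \<le> v \<bullet> (L *v v)" for v
    unfolding qL[symmetric] using LIMSEQ_le_const[OF q[of v]] psd by blast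
  ultimately show thesis
    using limv ql qL that[of L] by (simp add: form_le_def)
qed

text \<open>Read \<open>G\<close> as a right inverse on \<open>H\<close> of \<open>M = (\<Sum>i. a i z i z i')\<close>: the sum is the trace of \<open>M G\<close>
  over an orthonormal basis of \<open>H\<close>. With \<open>H\<close> a proper subspace this replaces a spectral decomposition.\<close>

lemma trace_on_subspace:
  fixes z :: "'i \<Rightarrow> 'a::euclidean_space" and G :: "'a \<Rightarrow> 'a"
  assumes I: "finite I" and H: "subspace H" and G: "linear G"
    and repr: "\<And>b. b \<in> H \<Longrightarrow> (\<Sum>i\<in>I. (a i * (z i \<bullet> G b)) *\<^sub>R z i) = b"
    and off: "\<And>i b. i \<in> I \<Longrightarrow> z i \<notin> H \<Longrightarrow> b \<in> H \<Longrightarrow> a i * (z i \<bullet> G b) = 0"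
  shows "(\<Sum>i | i \<in> I \<and> z i \<in> H. a i * (z i \<bullet> G (z i))) = real (dim H)"
proof -
  obtain B where B: "B \<subseteq> H" "pairwise orthogonal B" "\<And>x. x \<in> B \<Longrightarrow> norm x = 1"
    "independent B" "card B = dim H" "span B = H"
    using orthonormal_basis_subspace[OF H] by blast
  have finB: "finite B" using B(4) independent_imp_finite by blast
  have "a i * (z i \<bullet> G (z i)) = (\<Sum>b\<in>B. b \<bullet> ((a i * (z i \<bullet> G b)) *\<^sub>R z i))" if "z i \<in> H" for i
  proof -
    have "z i = (\<Sum>b\<in>B. (z i \<bullet> b) *\<^sub>R b)"
      using orthonormal_basis_expand[OF B(2,3) _ finB, of "z i"] B(6) that by simp
    then have "G (z i) = (\<Sum>b\<in>B. (z i \<bullet> b) *\<^sub>R G b)"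
      using linear_sum[OF G, of "\<lambda>b. (z i \<bullet> b) *\<^sub>R b" B] by (simp add: linear_scale[OF G])
    then show ?thesis
      by (simp add: inner_sum_right sum_distrib_left algebra_simps inner_commute)
  qed
  then have "(\<Sum>i | i \<in> I \<and> z i \<in> H. a i * (z i \<bullet> G (z i)))
      = (\<Sum>i | i \<in> I \<and> z i \<in> H. \<Sum>b\<in>B. b \<bullet> ((a i * (z i \<bullet> G b)) *\<^sub>R z i))"
    by simp
  also have "\<dots> = (\<Sum>b\<in>B. b \<bullet> (\<Sum>i | i \<in> I \<and> z i \<in> H. (a i * (z i \<bullet> G b)) *\<^sub>R z i))"
    by (subst sum.swap) (simp add: inner_sum_right)
  \<comment> \<open>By \<open>off\<close>, points outside \<open>H\<close> add nothing, so the sum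
    may run over all of \<open>I\<close> and \<open>repr\<close> collapses it to
    \<open>b\<close>.\<close>
  also have "\<dots> = (\<Sum>b\<in>B. b \<bullet> (\<Sum>i\<in>I. (a i * (z i \<bullet> G b)) *\<^sub>R z i))"
    using off B(1) I by (intro sum.cong refl arg_cong2[of _ _ _ _ inner] sum.mono_neutral_left) fastforce+
  also have "\<dots> = (\<Sum>b\<in>B. 1)"
    using repr B(1,3) by (intro sum.cong) (auto simp: norm_eq_1)
  finally show ?thesis using B(5) by simp
qed

lemma outer_mult: "outer x *v w = (x \<bullet> w) *\<^sub>R x"
  by (simp add: outer_def matrix_vector_mult_def vec_eq_iff inner_vec_def sum_distrib_left mult_ac)

subsection \<open>Weight functions\<close>

text \<open>The sign of \<open>u 0\<close> is unconstrained; the value matters only for points at the centre, whose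
  outer product vanishes. Hence the hypotheses \<open>0 < s\<close> below.\<close>

locale scatter_weight_function =
  fixes u :: "real \<Rightarrow> real"
  assumes weight: "scatter_weight u" and K_pos: "0 < psi_sup u"
begin

lemma bdd_above_psi: "bdd_above (psi u ` {0<..})"
proof -
  have "psi u ` {0<..} \<subseteq> psi u ` {0..}" by auto
  then show ?thesis
    using weight bounded_imp_bdd_above bounded_subset unfolding scatter_weight_def by metis
qed

lemma psi_le_sup: "0 < s \<Longrightarrow> psi u s \<le> psi_sup u"
  unfolding psi_sup_def using bdd_above_psi by (intro cSUP_upper) auto

lemma psi_mono: "0 < s \<Longrightarrow> s \<le> s' \<Longrightarrow> psi u s \<le> psi u s'"
  using weight by (auto simp: scatter_weight_def mono_on_def)

lemma weight_antimono: "0 < s \<Longrightarrow> s \<le> s' \<Longrightarrow> u s' \<le> u s"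
  using weight by (auto simp: scatter_weight_def monotone_on_def)

lemma psi_exceeds:
  assumes "l < psi_sup u" obtains s where "0 < s" "l < psi u s"
  using assms less_cSUP_iff[OF _ bdd_above_psi, of l] unfolding psi_sup_def by auto

lemma psi_tendsto_sup: "(psi u \<longlongrightarrow> psi_sup u) at_top"
proof (rule increasing_tendsto)
  show "\<forall>\<^sub>F s in at_top. psi u s \<le> psi_sup u"
    using psi_le_sup by (intro eventually_at_top_linorderI[of 1]) auto
  fix l assume "l < psi_sup u"
  then obtain s where "0 < s" "l < psi u s" by (rule psi_exceeds)
  then show "\<forall>\<^sub>F s in at_top. l < psi u s"
    using psi_mono by (intro eventually_at_top_linorderI[of s]) (metis less_le_trans)
qed

lemma weight_nonneg: "0 < s \<Longrightarrow> 0 \<le> u s"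
  using weight by (auto simp: scatter_weight_def)

text \<open>Far out \<open>psi\<close> is positive, hence so is \<open>u\<close>; and
  \<open>u\<close> is non-increasing.\<close>

lemma weight_pos:
  assumes "0 < s" shows "0 < u s"
proof (rule ccontr)
  assume "\<not> 0 < u s"
  obtain s' where s': "0 < s'" "0 < psi u s'" using psi_exceeds[OF K_pos] .
  have "0 < psi u (max s s')" using psi_mono[OF s'(1), of "max s s'"] s' by simp
  then have "0 < u (max s s')" using assms by (simp add: psi_def zero_less_mult_iff)
  moreover have "u (max s s') \<le> u s" using weight_antimono[OF assms] by simp
  ultimately show False using \<open>\<not> 0 < u s\<close> by linarith
qed

lemma weight_bounded:
  obtains M where "0 < M" "\<And>s. 0 \<le> s \<Longrightarrow> u s \<le> M"
proof -
  obtain M where "0 < M" "\<forall>x\<in>u ` {0..}. norm x \<le> M"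
    using weight unfolding scatter_weight_def bounded_pos by metis
  then show thesis using that[of M] by force
qed

text \<open>Below its supremum \<open>psi\<close> is strictly increasing, so a flat stretch can only
  occur at the top level.\<close>

lemma psi_eq_imp_sup:
  assumes "0 < s" "s < s'" "psi u s = psi u s'" shows "psi u s = psi_sup u"
proof (rule ccontr)
  assume "psi u s \<noteq> psi_sup u"
  then have "psi u s < psi_sup u" using psi_le_sup[OF assms(1)] by simp
  moreover have "strict_mono_on {s. 0 < s \<and> psi u s < psi_sup u} (psi u)"
    using weight by (simp add: scatter_weight_def)
  ultimately have "psi u s < psi u s'"
    using assms strict_mono_onD[of "{s. 0 < s \<and> psi u s < psi_sup u}" "psi u" s s'] by simp
  then show False using assms by simp
qed

lemma weight_tendsto: "0 < l \<Longrightarrow> (f \<longlongrightarrow> l) F \<Longrightarrow> ((\<lambda>x. u (f x)) \<longlongrightarrow> u l) F"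
  using weight continuous_on_tendsto_compose[of "{0<..}" u f l F] order_tendstoD(1)[of f l F 0]
  by (auto simp: scatter_weight_def)

lemma weight_tendsto_0: "(u \<longlongrightarrow> 0) at_top"
proof -
  have "((\<lambda>s. psi u s * inverse s) \<longlongrightarrow> psi_sup u * 0) at_top"
    by (intro tendsto_mult psi_tendsto_sup tendsto_inverse_0_at_top filterlim_ident)
  moreover have "\<forall>\<^sub>F s in at_top. psi u s * inverse s = u s"
    by (intro eventually_at_top_linorderI[of 1]) (auto simp: psi_def)
  ultimately show ?thesis using tendsto_cong by force
qed

end

subsection \<open>Existence and uniqueness\<close>

text \<open>A finite weighted family of centred points replaces the multiset; \<open>c i\<close>
  stands for multiplicity over sample size. \<open>subspace_mass\<close> says that the mass off a
  proper subspace exceeds its codimension divided by \<open>psi_sup u\<close>.\<close>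

locale scatter_cloud = scatter_weight_function u
  for u :: "real \<Rightarrow> real" +
  fixes I :: "'i set" and c :: "'i \<Rightarrow> real" and z :: "'i \<Rightarrow> real^'p"
  assumes fin: "finite I" and c_pos: "i \<in> I \<Longrightarrow> 0 < c i"
    and subspace_mass: "subspace H \<Longrightarrow> H \<noteq> UNIV \<Longrightarrow>
      sum c {i\<in>I. z i \<in> H} < sum c I - (real CARD('p) - real (dim H)) / psi_sup u"
begin

definition dsq :: "real^'p^'p \<Rightarrow> 'i \<Rightarrow> real" where
  "dsq V i = z i \<bullet> (matrix_inv V *v z i)"

text \<open>Its positive definite fixed points are the estimates, with the averaging factor absorbed
  into \<open>c\<close>.\<close>

definition scatter_map :: "real^'p^'p \<Rightarrow> real^'p^'p" where
  "scatter_map V = (\<Sum>i\<in>I. (c i * u (dsq V i)) *\<^sub>R outer (z i))"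

lemma scatter_map_mult:
  "scatter_map V *v w = (\<Sum>i\<in>I. (c i * u (dsq V i) * (z i \<bullet> w)) *\<^sub>R z i)"
proof -
  have "sum f J *v w = (\<Sum>i\<in>J. f i *v w)" if "finite J" for f :: "'i \<Rightarrow> real^'p^'p" and J
    using that by (induction J) (auto simp: matrix_vector_mult_add_rdistrib)
  then show ?thesis
    using fin by (simp add: scatter_map_def outer_mult flip: scaleR_matrix_vector_assoc)
qed

lemma scatter_map_form:
  "w \<bullet> (scatter_map V *v w) = (\<Sum>i\<in>I. c i * u (dsq V i) * (z i \<bullet> w)\<^sup>2)"
  by (simp add: scatter_map_mult inner_sum_right power2_eq_square inner_commute mult_ac)

lemma transpose_scatter_map: "transpose (scatter_map V) = scatter_map V"
  by (simp add: scatter_map_def transpose_def outer_def vec_eq_iff mult.commute)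

lemma dsq_pos: "sym_pos_def V \<Longrightarrow> z i \<noteq> 0 \<Longrightarrow> 0 < dsq V i"
  unfolding dsq_def by (rule pd_inv_pos)

lemma dsq_nonneg: "sym_pos_def V \<Longrightarrow> 0 \<le> dsq V i"
  unfolding dsq_def by (rule pd_inv_nonneg)

lemma dsq_antimono: "sym_pos_def A \<Longrightarrow> sym_pos_def B \<Longrightarrow> form_le A B \<Longrightarrow> dsq B i \<le> dsq A i"
  unfolding dsq_def by (rule form_le_inv)

text \<open>Otherwise the hyperplane orthogonal to \<open>w\<close> would carry all the mass, which
  \<open>subspace_mass\<close> forbids.\<close>

lemma nonorthogonal_point:
  assumes "w \<noteq> 0" obtains i where "i \<in> I" "z i \<bullet> w \<noteq> 0"
proof (rule ccontr)
  assume "\<not> thesis"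
  with that have all: "\<forall>i\<in>I. z i \<bullet> w = 0" by blast
  define H where "H = {x. x \<bullet> w = 0}"
  have "subspace H" by (simp add: H_def subspace_def inner_add_left)
  moreover have "w \<notin> H" using assms by (simp add: H_def)
  ultimately have "sum c {i\<in>I. z i \<in> H} < sum c I - (real CARD('p) - real (dim H)) / psi_sup u"
    by (intro subspace_mass) auto
  moreover have "{i\<in>I. z i \<in> H} = I" using all by (auto simp: H_def)
  moreover have "0 \<le> (real CARD('p) - real (dim H)) / psi_sup u"
    using dim_subset_UNIV_cart[of H] K_pos by simp
  ultimately show False by simp
qed

lemma scatter_map_pos_def:
  assumes V: "sym_pos_def V" shows "sym_pos_def (scatter_map V)"
proof -
  have "0 < w \<bullet> (scatter_map V *v w)" if "w \<noteq> 0" for w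
  proof -
    obtain j where j: "j \<in> I" "z j \<bullet> w \<noteq> 0" using nonorthogonal_point[OF \<open>w \<noteq> 0\<close>] .
    have *: "0 < u (dsq V i)" if "z i \<bullet> w \<noteq> 0" for i
      using that by (intro weight_pos dsq_pos V) auto
    show ?thesis unfolding scatter_map_form
    proof (rule sum_pos2[OF fin j(1)])
      show "0 < c j * u (dsq V j) * (z j \<bullet> w)\<^sup>2"
        using c_pos[OF j(1)] *[OF j(2)] j(2) by simp
      \<comment> \<open>A point orthogonal to \<open>w\<close> contributes 0, even if
        \<open>u\<close> is evaluated at 0, where its sign is unknown.\<close>
      show "0 \<le> c i * u (dsq V i) * (z i \<bullet> w)\<^sup>2" if "i \<in> I" for i
        using c_pos[OF that] *[of i] by (cases "z i \<bullet> w = 0") (auto simp: less_imp_le)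
    qed
  qed
  then show ?thesis by (simp add: sym_pos_def_def transpose_scatter_map)
qed

text \<open>Two reversals cancel: inversion reverses the order and \<open>u\<close> is
  non-increasing.\<close>

lemma scatter_map_mono:
  assumes "sym_pos_def A" "sym_pos_def B" "form_le A B"
  shows "form_le (scatter_map A) (scatter_map B)"
  unfolding form_le_def scatter_map_form
proof (intro allI sum_mono)
  fix w i assume i: "i \<in> I"
  show "c i * u (dsq A i) * (z i \<bullet> w)\<^sup>2 \<le> c i * u (dsq B i) * (z i \<bullet> w)\<^sup>2"
  proof (cases "z i = 0")
    case False
    have "u (dsq A i) \<le> u (dsq B i)"
      using dsq_pos[OF assms(2) False] dsq_antimono[OF assms] by (rule weight_antimono)
    then show ?thesis using c_pos[OF i] by (intro mult_right_mono mult_left_mono) auto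
  qed simp
qed

text \<open>Boundedness of \<open>u\<close> gives a bound independent of \<open>V\<close>. Hence
  \<open>C *\<^sub>R mat 1\<close> is mapped below itself and can start a decreasing
  iteration.\<close>

lemma scatter_map_upper_bound:
  obtains C where "0 < C" "\<And>V. sym_pos_def V \<Longrightarrow> form_le (scatter_map V) (C *\<^sub>R mat 1)"
proof -
  obtain M where M: "0 < M" "\<And>s. 0 \<le> s \<Longrightarrow> u s \<le> M" using weight_bounded by blast
  define C where "C = (\<Sum>i\<in>I. c i * M * (z i \<bullet> z i)) + 1"
  have "0 \<le> (\<Sum>i\<in>I. c i * M * (z i \<bullet> z i))"
    using M c_pos by (intro sum_nonneg) (simp add: less_imp_le)
  then have "0 < C" by (simp add: C_def)
  moreover have "form_le (scatter_map V) (C *\<^sub>R mat 1)" if V: "sym_pos_def V" for V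
    unfolding form_le_def
  proof
    fix w
    have "w \<bullet> (scatter_map V *v w) \<le> (\<Sum>i\<in>I. c i * M * ((z i \<bullet> z i) * (w \<bullet> w)))"
      unfolding scatter_map_form
    proof (intro sum_mono mult_mono[OF _ Cauchy_Schwarz_ineq])
      fix i assume "i \<in> I"
      then show "c i * u (dsq V i) \<le> c i * M" "0 \<le> c i * M"
        using M c_pos[of i] dsq_nonneg[OF V] by (auto intro!: mult_left_mono simp: less_imp_le)
    qed simp
    also have "\<dots> = (C - 1) * (w \<bullet> w)"
      by (simp add: C_def sum_distrib_right mult.assoc)
    also have "\<dots> \<le> C * (w \<bullet> w)"
      by (simp add: algebra_simps)
    also have "\<dots> = w \<bullet> ((C *\<^sub>R mat 1) *v w)"
      by (simp flip: scaleR_matrix_vector_assoc)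
    finally show "w \<bullet> (scatter_map V *v w) \<le> w \<bullet> ((C *\<^sub>R mat 1) *v w)" .
  qed
  ultimately show thesis by (rule that)
qed

text \<open>Both sides are the trace of \<open>V V^-1\<close>. Weights and distances may come from
  different matrices, as happens for consecutive iterates.\<close>

lemma weighted_dsq_sum:
  assumes V: "sym_pos_def V" and eq: "V = scatter_map A"
  shows "(\<Sum>i\<in>I. c i * u (dsq A i) * dsq V i) = real CARD('p)"
proof -
  have "(\<Sum>i | i \<in> I \<and> z i \<in> UNIV. c i * u (dsq A i) * (z i \<bullet> (matrix_inv V *v z i)))
      = real (dim (UNIV :: (real^'p) set))"
  proof (rule trace_on_subspace[OF fin])
    fix b :: "real^'p"
    have "scatter_map A *v (matrix_inv V *v b) = b"
      unfolding eq[symmetric] by (rule pd_mult_inv[OF V])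
    then show "(\<Sum>i\<in>I. (c i * u (dsq A i) * (z i \<bullet> (matrix_inv V *v b))) *\<^sub>R z i) = b"
      by (simp add: scatter_map_mult)
  qed auto
  then show ?thesis by (simp add: dsq_def)
qed

section \<open>Uniqueness of the fixed point\<close>

text \<open>Applied in both orders, this gives uniqueness through \<open>form_le_antisym\<close>. It
  suffices that the largest ratio of the two forms is at most 1.\<close>

lemma scatter_fixed_point_le:
  assumes A: "sym_pos_def A" "A = scatter_map A" and B: "sym_pos_def B" "B = scatter_map B"
  shows "form_le B A"
proof -
  define R where "R v = (v \<bullet> (B *v v)) / (v \<bullet> (A *v v))" for v
  have cont: "continuous_on (sphere 0 1) R"
    unfolding R_def
  proof (intro continuous_intros ballI)
    fix v :: "real^'p" assume "v \<in> sphere 0 1"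
    then have "v \<noteq> 0" by auto
    then show "v \<bullet> (A *v v) \<noteq> 0" using pd_pos[OF A(1), of v] by simp
  qed
  have "sphere (0::real^'p) 1 \<noteq> {}" by simp
  \<comment> \<open>Compactness of the unit sphere supplies a maximizer of the ratio; homogeneity
    extends the bound to all vectors.\<close>
  then obtain b where b: "b \<in> sphere 0 1" and bmax: "\<And>v. v \<in> sphere 0 1 \<Longrightarrow> R v \<le> R b"
    using continuous_attains_sup[OF compact_sphere _ cont] by blast
  define l where "l = R b"
  have b0: "b \<noteq> 0" using b by auto
  have le: "v \<bullet> (B *v v) \<le> l * (v \<bullet> (A *v v))" for v
  proof (cases "v = 0")
    case False
    define w where "w = inverse (norm v) *\<^sub>R v"
    have "R w \<le> l" unfolding l_def using False by (intro bmax) (simp add: w_def)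
    moreover have "R w = R v"
      using False by (simp add: R_def w_def matrix_vector_mult_scaleR)
    ultimately have "R v \<le> l" by simp
    then show ?thesis
      using pd_pos[OF A(1) False] by (simp add: R_def divide_le_eq)
  qed simp
  have "l \<le> 1"
  proof (rule ccontr)
    assume "\<not> l \<le> 1"
    then have l: "1 < l" by simp
    \<comment> \<open>The eigenspace of the pair for the top ratio. It contains \<open>b\<close>
      because the form of \<open>l A - B\<close> is nonnegative and vanishes at
      \<open>b\<close>.\<close>
    define L where "L = {v. B *v v = l *\<^sub>R (A *v v)}"
    define K where "K = psi_sup u"
    have subL: "subspace L"
      by (auto simp: L_def subspace_def matrix_vector_right_distrib matrix_vector_mult_scaleR
          scaleR_add_right)
    have D: "(l *\<^sub>R A - B) *v v = l *\<^sub>R (A *v v) - B *v v" for v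
      by (simp add: matrix_vector_mult_diff_rdistrib scaleR_matrix_vector_assoc)
    have bL: "b \<in> L"
    proof -
      have "(l *\<^sub>R A - B) *v b = 0"
      proof (rule psd_kernel)
        show "transpose (l *\<^sub>R A - B) = l *\<^sub>R A - B"
          using A(1) B(1) by (simp add: sym_pos_def_def transpose_def vec_eq_iff)
        show "0 \<le> v \<bullet> ((l *\<^sub>R A - B) *v v)" for v
          using le[of v] by (simp add: D inner_diff_right)
        show "b \<bullet> ((l *\<^sub>R A - B) *v b) = 0"
          unfolding D using pd_pos[OF A(1) b0] by (simp add: inner_diff_right l_def R_def)
      qed
      then show ?thesis by (simp add: L_def D)
    qed
    \<comment> \<open>A point not orthogonal to \<open>L\<close> has saturated \<open>psi\<close>
      and lies in \<open>A L\<close>: a chain of inequalities is forced to consist of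
      equalities.\<close>
    have key: "psi u (dsq A i) = K \<and> matrix_inv A *v z i \<in> L"
      if i: "i \<in> I" and v: "v \<in> L" and zv: "z i \<bullet> v \<noteq> 0" for i v
    proof -
      \<comment> \<open>\<open>B \<le> l A\<close> reverses under inversion; the trial vector is the
        maximizer for \<open>l A\<close>.\<close>
      have dle: "dsq A j / l \<le> dsq B j" for j
      proof -
        define h where "h = (1 / l) *\<^sub>R (matrix_inv A *v z j)"
        have "A *v h = (1 / l) *\<^sub>R z j"
          by (simp add: h_def matrix_vector_mult_scaleR pd_mult_inv[OF A(1)])
        then have "h \<bullet> (B *v h) \<le> h \<bullet> z j"
          using le[of h] l by simp
        moreover have "h \<bullet> z j = dsq A j / l"
          by (simp add: h_def dsq_def inner_commute)
        ultimately show ?thesis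
          using pd_dual_le[OF B(1), of h "z j"] by (simp add: dsq_def)
      qed
      \<comment> \<open>The first bound is monotonicity of \<open>u\<close>, the second that of
        \<open>psi\<close> between \<open>dsq A j / l\<close> and \<open>dsq A j\<close>.\<close>
      have weights: "u (dsq B j) \<le> u (dsq A j / l) \<and> u (dsq A j / l) \<le> l * u (dsq A j)"
        if "z j \<noteq> 0" for j
      proof
        have s: "0 < dsq A j / l" using dsq_pos[OF A(1) that] l by simp
        then show "u (dsq B j) \<le> u (dsq A j / l)" using dle by (rule weight_antimono)
        have "dsq A j / l \<le> dsq A j"
          using l dsq_pos[OF A(1) that] by (simp add: field_simps)
        from psi_mono[OF s this] show "u (dsq A j / l) \<le> l * u (dsq A j)"
          using l dsq_pos[OF A(1) that] by (simp add: psi_def field_simps)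
      qed
      \<comment> \<open>Each gap is nonnegative, and their sum is the form of \<open>l A - B\<close>
        at \<open>v\<close>, which is 0 on \<open>L\<close>. So every gap vanishes.\<close>
      define gap where "gap j = c j * (l * u (dsq A j) - u (dsq B j)) * (z j \<bullet> v)\<^sup>2" for j
      have gap_nonneg: "0 \<le> gap j" if "j \<in> I" for j
        using weights[of j] c_pos[OF that] unfolding gap_def
        by (cases "z j = 0") auto
      have "v \<bullet> (B *v v) = l * (v \<bullet> (A *v v))" using v by (simp add: L_def)
      then have "(\<Sum>j\<in>I. gap j) = 0"
        unfolding gap_def
        using scatter_map_form[of v A] scatter_map_form[of v B] A(2) B(2)
        by (simp add: algebra_simps sum_subtractf sum_distrib_left)
      then have "gap i = 0"
        using gap_nonneg fin i by (simp add: sum_nonneg_eq_0_iff)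
      then have uB: "u (dsq B i) = l * u (dsq A i)"
        using c_pos[OF i] zv by (simp add: gap_def)
      have zi: "z i \<noteq> 0" using zv by auto
      have sA: "0 < dsq A i" and sB: "0 < dsq B i"
        using zi by (simp_all add: dsq_pos A(1) B(1))
      have uAl: "u (dsq A i / l) = l * u (dsq A i)" and uBl: "u (dsq B i) = u (dsq A i / l)"
        using weights[OF zi] uB by simp_all
      have lt: "dsq A i / l < dsq A i" "0 < dsq A i / l" using l sA by (simp_all add: field_simps)
      \<comment> \<open>Equality of the weights gives \<open>psi\<close> the same value at two
        distinct arguments, which only happens at its supremum.\<close>
      have "psi u (dsq A i / l) = psi u (dsq A i)"
        using l by (simp add: psi_def uAl)
      with psi_eq_imp_sup[OF lt(2,1)] have psiA: "psi u (dsq A i) = K" "psi u (dsq A i / l) = K"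
        by (simp_all add: K_def)
      \<comment> \<open>Since \<open>dsq A i / l \<le> dsq B i\<close>, saturation passes on to
        \<open>dsq B i\<close>; equal positive weights then make the distances equal.\<close>
      have "psi u (dsq B i) = K"
        using psi_mono[OF lt(2) dle] psi_le_sup[OF sB] psiA(2) by (simp add: K_def)
      then have "dsq B i * u (dsq A i / l) = dsq A i / l * u (dsq A i / l)"
        using psiA(2) by (simp add: psi_def uBl)
      then have sBA: "dsq B i = dsq A i / l"
        using weight_pos[OF lt(2)] by (metis less_irrefl mult_right_cancel)
      \<comment> \<open>Equal distances are the equality case of the dual bound, hence
        \<open>B h = z i = l A h\<close>.\<close>
      define h where "h = (1 / l) *\<^sub>R (matrix_inv A *v z i)"
      have Ah: "A *v h = (1 / l) *\<^sub>R z i"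
        by (simp add: h_def matrix_vector_mult_scaleR pd_mult_inv[OF A(1)])
      have hz: "h \<bullet> z i = dsq A i / l" by (simp add: h_def dsq_def inner_commute)
      have "h \<bullet> (B *v h) \<le> h \<bullet> z i"
        using le[of h] l Ah by simp
      then have "B *v h = z i"
        using sBA hz by (intro pd_dual_eq[OF B(1)]) (simp add: dsq_def)
      then have "h \<in> L" using Ah l by (simp add: L_def)
      then have "l *\<^sub>R h \<in> L" by (rule subspace_scale[OF subL])
      then show ?thesis using psiA(1) l by (simp add: h_def)
    qed
    \<comment> \<open>\<open>P\<close> below is the orthogonal complement of \<open>L\<close>; by
      \<open>key\<close>, each point outside \<open>P\<close> lies in \<open>H\<close> and has
      \<open>psi\<close> value \<open>K\<close>.\<close>
    define H where "H = (*v) A ` L"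
    define P where "P = {y. \<forall>x\<in>L. orthogonal x y}"
    have subH: "subspace H" unfolding H_def by (rule linear_subspace_image[OF matrix_vector_mul_linear subL])
    have injA: "inj ((*v) A)" by (metis injI pd_inv_mult[OF A(1)])
    have dimH: "dim H = dim L"
      unfolding H_def by (rule dim_image_eq) (auto intro: inj_on_subset[OF injA])
    have inH: "z i \<in> H" if "matrix_inv A *v z i \<in> L" for i
      unfolding H_def using that pd_mult_inv[OF A(1), of "z i"] by (metis imageI)
    have "(\<Sum>i | i \<in> I \<and> z i \<in> H. c i * u (dsq A i) * (z i \<bullet> (matrix_inv A *v z i))) = real (dim H)"
    proof (rule trace_on_subspace[OF fin subH])
      fix x
      have "scatter_map A *v (matrix_inv A *v x) = x"
        unfolding A(2)[symmetric] by (rule pd_mult_inv[OF A(1)])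
      then show "(\<Sum>i\<in>I. (c i * u (dsq A i) * (z i \<bullet> (matrix_inv A *v x))) *\<^sub>R z i) = x"
        by (simp add: scatter_map_mult)
    next
      fix i x assume i: "i \<in> I" "z i \<notin> H" and "x \<in> H"
      then have "matrix_inv A *v x \<in> L" by (auto simp: H_def pd_inv_mult[OF A(1)])
      with key[OF i(1) this] inH[of i] i(2)
      show "c i * u (dsq A i) * (z i \<bullet> (matrix_inv A *v x)) = 0" by auto
    qed auto
    then have trace: "(\<Sum>i | i \<in> I \<and> z i \<in> H. c i * psi u (dsq A i)) = real (dim L)"
      by (simp add: dsq_def psi_def dimH mult_ac)
    \<comment> \<open>The trace bounds \<open>K\<close> times the mass off \<open>P\<close> by
      \<open>dim L\<close>, the codimension of \<open>P\<close>; \<open>subspace_mass\<close> for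
      \<open>P\<close> says the opposite.\<close>
    have "K * sum c {i\<in>I. z i \<notin> P} = (\<Sum>i | i \<in> I \<and> z i \<notin> P. c i * psi u (dsq A i))"
      unfolding sum_distrib_left using key by (intro sum.cong) (auto simp: P_def orthogonal_def inner_commute)
    also have "\<dots> \<le> (\<Sum>i | i \<in> I \<and> z i \<in> H. c i * psi u (dsq A i))"
    proof (rule sum_mono2)
      show "{i \<in> I. z i \<notin> P} \<subseteq> {i \<in> I. z i \<in> H}"
        using key inH by (auto simp: P_def orthogonal_def inner_commute)
      show "0 \<le> c i * psi u (dsq A i)" if "i \<in> {i \<in> I. z i \<in> H} - {i \<in> I. z i \<notin> P}" for i
        using that c_pos[of i] dsq_pos[OF A(1), of i] weight_nonneg[of "dsq A i"]
        by (cases "z i = 0") (auto simp: psi_def dsq_def)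
    qed (use fin in auto)
    finally have upper: "K * sum c {i\<in>I. z i \<notin> P} \<le> real (dim L)" using trace by simp
    have subP: "subspace P" unfolding P_def by (rule subspace_orthogonal_to_vectors)
    have "P \<noteq> UNIV"
    proof
      assume "P = UNIV"
      then have "orthogonal b b" using bL by (auto simp: P_def)
      then show False using b0 by (simp add: orthogonal_def)
    qed
    have "dim P + dim L = CARD('p)"
      using dim_subspace_orthogonal_to_vectors[OF subL subspace_UNIV] by (simp add: P_def)
    then have "real CARD('p) - real (dim P) = real (dim L)" by linarith
    then have "sum c {i\<in>I. z i \<in> P} < sum c I - real (dim L) / K"
      using subspace_mass[OF subP \<open>P \<noteq> UNIV\<close>] by (simp add: K_def)
    moreover have "sum c I = sum c {i\<in>I. z i \<in> P} + sum c {i\<in>I. z i \<notin> P}"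
      using fin by (subst sum.union_disjoint[symmetric]) (auto intro: sum.cong)
    ultimately have "real (dim L) / K < sum c {i\<in>I. z i \<notin> P}" by simp
    then show False using upper K_pos by (simp add: K_def field_simps)
  qed
  show ?thesis unfolding form_le_def
  proof
    fix v
    show "v \<bullet> (B *v v) \<le> v \<bullet> (A *v v)"
      using le[of v] mult_right_mono[OF \<open>l \<le> 1\<close> pd_nonneg[OF A(1), of v]] by simp
  qed
qed

section \<open>Existence of a fixed point\<close>

lemma scatter_fixed_point_exists:
  obtains V where "sym_pos_def V" "V = scatter_map V"
proof -
  define K where "K = psi_sup u"
  obtain C where C: "0 < C" "\<And>V. sym_pos_def V \<Longrightarrow> form_le (scatter_map V) (C *\<^sub>R mat 1)"
    using scatter_map_upper_bound by blast
  define V where "V k = (scatter_map ^^ k) (C *\<^sub>R mat 1)" for k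
  have V_Suc: "V (Suc k) = scatter_map (V k)" for k by (simp add: V_def)
  have V0: "sym_pos_def (V 0)"
    using C(1) by (simp add: V_def sym_pos_def_def transpose_scalar transpose_mat flip: scaleR_matrix_vector_assoc)
  have pd: "sym_pos_def (V k)" for k
    by (induction k) (simp_all add: V0 V_Suc scatter_map_pos_def)
  \<comment> \<open>The choice of \<open>C\<close> gives the first descent, monotonicity of the map
    all later ones.\<close>
  have dec: "form_le (V (Suc k)) (V k)" for k
  proof (induction k)
    case 0
    show ?case using C(2)[OF V0] by (simp add: V_def)
  next
    case (Suc k)
    then show ?case unfolding V_Suc[of "Suc k"] V_Suc[of k]
      using pd scatter_map_mono by (metis V_Suc)
  qed
  have "transpose (V k) = V k" for k using pd by (simp add: sym_pos_def_def)
  then obtain L where L: "transpose L = L" "\<And>v. 0 \<le> v \<bullet> (L *v v)" "\<And>k. form_le L (V k)"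
    and limV: "\<And>w. (\<lambda>k. V k *v w) \<longlonglongrightarrow> L *v w"
    using decreasing_forms_converge[of V] pd_nonneg[OF pd] dec by metis
  define H where "H = range ((*v) L)"
  have subH: "subspace H"
    unfolding H_def by (rule linear_subspace_image[OF matrix_vector_mul_linear subspace_UNIV])
  \<comment> \<open>\<open>g\<close> inverts \<open>L\<close> on its range and stands in for the
    inverse while \<open>L\<close> may be singular.\<close>
  obtain g where g: "linear g" "\<And>v. v \<in> H \<Longrightarrow> L *v (g v) = v"
    using linear_exists_right_inverse_on[OF matrix_vector_mul_linear subspace_UNIV, of L]
    unfolding H_def by auto
  have dsq_inc: "incseq (\<lambda>k. dsq (V k) i)" for i
    using dsq_antimono[OF pd pd dec] by (simp add: incseq_Suc_iff)
  \<comment> \<open>From below, the dual bound with trial vector \<open>g (z i)\<close>; from above,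
    \<open>L \<le> V k\<close> and the \<open>L\<close>-form at \<open>h - w\<close>.\<close>
  have lim_in: "(\<lambda>k. dsq (V k) i) \<longlonglongrightarrow> z i \<bullet> g (z i)" if "z i \<in> H" for i
  proof (rule tendsto_sandwich[OF _ _ _ tendsto_const])
    define w where "w = g (z i)"
    have Lw: "L *v w = z i" using g(2)[OF that] by (simp add: w_def)
    show "\<forall>\<^sub>F k in sequentially. 2 * (w \<bullet> z i) - w \<bullet> (V k *v w) \<le> dsq (V k) i"
      unfolding dsq_def using pd_dual_le[OF pd] by (intro always_eventually) blast
    have "dsq (V k) i \<le> z i \<bullet> g (z i)" for k
    proof -
      define h where "h = matrix_inv (V k) *v z i"
      have h: "h \<bullet> z i = dsq (V k) i" "h \<bullet> (V k *v h) = dsq (V k) i"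
        by (simp_all add: h_def dsq_def pd_mult_inv[OF pd] inner_commute)
      have "0 \<le> (h - w) \<bullet> (L *v (h - w))" by (rule L)
      also have "\<dots> = h \<bullet> (L *v h) - 2 * (h \<bullet> z i) + w \<bullet> z i"
        using sym_inner[OF L(1), of w h]
        by (simp add: matrix_vector_mult_diff_distrib inner_diff Lw inner_commute)
      also have "\<dots> \<le> w \<bullet> z i - dsq (V k) i"
        using L(3)[of k] h by (auto simp: form_le_def dest: spec[of _ h])
      finally show ?thesis by (simp add: w_def inner_commute)
    qed
    then show "\<forall>\<^sub>F k in sequentially. dsq (V k) i \<le> z i \<bullet> g (z i)"
      by (intro always_eventually) blast
    have "(\<lambda>k. 2 * (w \<bullet> z i) - w \<bullet> (V k *v w)) \<longlonglongrightarrow> 2 * (w \<bullet> z i) - w \<bullet> (L *v w)"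
      by (intro tendsto_intros limV)
    then show "(\<lambda>k. 2 * (w \<bullet> z i) - w \<bullet> (V k *v w)) \<longlonglongrightarrow> z i \<bullet> g (z i)"
      by (simp add: Lw inner_commute flip: w_def)
  qed
  \<comment> \<open>The component \<open>b\<close> of \<open>z i\<close> orthogonal to
    \<open>H\<close> lies in the kernel of \<open>L\<close>, so its form under \<open>V k\<close>
    tends to 0 and Cauchy-Schwarz drives the distance to infinity.\<close>
  have lim_out: "filterlim (\<lambda>k. dsq (V k) i) at_top sequentially" if zi: "z i \<notin> H" for i
  proof -
    obtain y b where y: "y \<in> span H" and bw: "\<And>w. w \<in> span H \<Longrightarrow> orthogonal b w" and zyb: "z i = y + b"
      using orthogonal_subspace_decomp_exists[of H "z i"] by metis
    have spanH: "span H = H" using subH by (simp add: span_eq_iff)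
    have b0: "b \<noteq> 0" using y zi spanH zyb by auto
    have "L *v (L *v b) \<in> span H" unfolding spanH by (simp add: H_def)
    from bw[OF this] have "b \<bullet> (L *v (L *v b)) = 0" by (simp add: orthogonal_def)
    then have Lb: "L *v b = 0" using sym_inner[OF L(1), of b "L *v b"] by simp
    have bz: "b \<bullet> z i = b \<bullet> b" using bw[OF y] zyb by (simp add: inner_add_right orthogonal_def)
    have q: "(\<lambda>k. b \<bullet> (V k *v b)) \<longlonglongrightarrow> 0"
      using tendsto_inner[OF tendsto_const[of b] limV[of b]] by (simp add: Lb)
    have qpos: "0 < b \<bullet> (V k *v b)" for k by (rule pd_pos[OF pd b0])
    have "filterlim (\<lambda>k. b \<bullet> (V k *v b)) (at_right 0) sequentially"
      using q qpos by (auto simp: filterlim_at intro!: always_eventually less_imp_neq[THEN not_sym])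
    then have "filterlim (\<lambda>k. (b \<bullet> b)\<^sup>2 * inverse (b \<bullet> (V k *v b))) at_top sequentially"
      using b0 by (intro filterlim_tendsto_pos_mult_at_top[OF tendsto_const]
        filterlim_compose[OF filterlim_inverse_at_top_right]) auto
    then show ?thesis
    proof (rule filterlim_at_top_mono)
      have "(b \<bullet> b)\<^sup>2 * inverse (b \<bullet> (V k *v b)) \<le> dsq (V k) i" for k
        using pd_Cauchy_Schwarz[OF pd, of b "z i" k] qpos[of k]
        by (simp add: dsq_def bz field_simps)
      then show "\<forall>\<^sub>F k in sequentially. (b \<bullet> b)\<^sup>2 * inverse (b \<bullet> (V k *v b)) \<le> dsq (V k) i"
        by simp
    qed
  qed
  have lim_pos: "0 < z i \<bullet> g (z i)" if "z i \<in> H" "z i \<noteq> 0" for i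
    using dsq_pos[OF V0 that(2)] incseq_le[OF dsq_inc lim_in[OF that(1)], of 0] by simp
  \<comment> \<open>The limiting weights: off \<open>H\<close> the distances diverge and
    \<open>u\<close> tends to 0, so those points drop out of \<open>L\<close>.\<close>
  define a where "a i = (if z i \<in> H then c i * u (z i \<bullet> g (z i)) else 0)" for i
  have L_eq: "L *v w = (\<Sum>i\<in>I. (a i * (z i \<bullet> w)) *\<^sub>R z i)" for w
  proof (rule LIMSEQ_unique)
    show "(\<lambda>k. V (Suc k) *v w) \<longlonglongrightarrow> L *v w" using limV by (rule LIMSEQ_Suc)
    show "(\<lambda>k. V (Suc k) *v w) \<longlonglongrightarrow> (\<Sum>i\<in>I. (a i * (z i \<bullet> w)) *\<^sub>R z i)"
      unfolding V_Suc scatter_map_mult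
    proof (rule tendsto_sum)
      fix i
      show "(\<lambda>k. (c i * u (dsq (V k) i) * (z i \<bullet> w)) *\<^sub>R z i) \<longlonglongrightarrow> (a i * (z i \<bullet> w)) *\<^sub>R z i"
      proof (cases "z i = 0")
        case False
        have "(\<lambda>k. c i * u (dsq (V k) i)) \<longlonglongrightarrow> a i"
        proof (cases "z i \<in> H")
          case True
          then show ?thesis unfolding a_def
            using lim_pos[OF True False] by (auto intro!: tendsto_intros weight_tendsto lim_in)
        next
          case outside: False
          have "(\<lambda>k. c i * u (dsq (V k) i)) \<longlonglongrightarrow> c i * 0"
            by (intro tendsto_intros filterlim_compose[OF weight_tendsto_0 lim_out[OF outside]])
          then show ?thesis using outside by (simp add: a_def)
        qed
        then show ?thesis by (intro tendsto_intros)
      qed simp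
    qed
  qed
  have trace: "(\<Sum>i | i \<in> I \<and> z i \<in> H. a i * (z i \<bullet> g (z i))) = real (dim H)"
    by (rule trace_on_subspace[OF fin subH g(1)]) (use g(2) L_eq in \<open>auto simp: a_def\<close>)
  have "H = UNIV"
  proof (rule ccontr)
    assume "H \<noteq> UNIV"
    \<comment> \<open>Distances increase along the iteration, so putting the old weight for the new
      one does not lower the sum, which is then \<open>p\<close> by the trace identity.\<close>
    have le_p: "(\<Sum>i\<in>I. c i * psi u (dsq (V (Suc k)) i)) \<le> real CARD('p)" for k
      unfolding weighted_dsq_sum[OF pd V_Suc, of k, symmetric]
    proof (rule sum_mono)
      fix i assume i: "i \<in> I"
      show "c i * psi u (dsq (V (Suc k)) i) \<le> c i * u (dsq (V k) i) * dsq (V (Suc k)) i"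
      proof (cases "z i = 0")
        case False
        have "u (dsq (V (Suc k)) i) \<le> u (dsq (V k) i)"
          using dsq_pos[OF pd False] incseqD[OF dsq_inc, of k "Suc k" i] by (intro weight_antimono) auto
        then have "dsq (V (Suc k)) i * u (dsq (V (Suc k)) i) \<le> dsq (V (Suc k)) i * u (dsq (V k) i)"
          using dsq_nonneg[OF pd] by (intro mult_left_mono)
        then show ?thesis using c_pos[OF i] by (simp add: psi_def mult_ac)
      qed (simp add: dsq_def psi_def)
    qed
    \<comment> \<open>In the limit points off \<open>H\<close> count with \<open>psi\<close> value
      \<open>K\<close> and the others sum to \<open>dim H\<close>. The total is at most
      \<open>p\<close>, contrary to \<open>subspace_mass\<close>.\<close>
    have "(\<lambda>k. \<Sum>i\<in>I. c i * psi u (dsq (V k) i)) \<longlonglongrightarrow>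
        (\<Sum>i\<in>I. if z i \<in> H then a i * (z i \<bullet> g (z i)) else K * c i)"
    proof (rule tendsto_sum)
      fix i
      show "(\<lambda>k. c i * psi u (dsq (V k) i)) \<longlonglongrightarrow> (if z i \<in> H then a i * (z i \<bullet> g (z i)) else K * c i)"
      proof (cases "z i \<in> H")
        case True
        show ?thesis
        proof (cases "z i = 0")
          case False
          have "(\<lambda>k. c i * (dsq (V k) i * u (dsq (V k) i))) \<longlonglongrightarrow> c i * (z i \<bullet> g (z i) * u (z i \<bullet> g (z i)))"
            using lim_pos[OF True False] by (intro tendsto_intros weight_tendsto lim_in True)
          then show ?thesis using True by (simp add: psi_def a_def mult_ac)
        qed (use True in \<open>simp add: dsq_def psi_def\<close>)
      next
        case False
        have "(\<lambda>k. c i * psi u (dsq (V k) i)) \<longlonglongrightarrow> c i * K"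
          unfolding K_def
          by (intro tendsto_intros filterlim_compose[OF psi_tendsto_sup lim_out[OF False]])
        then show ?thesis using False by (simp add: mult.commute)
      qed
    qed
    from LIMSEQ_le_const2[OF LIMSEQ_Suc[OF this]] le_p
    have "(\<Sum>i\<in>I. if z i \<in> H then a i * (z i \<bullet> g (z i)) else K * c i) \<le> real CARD('p)"
      by blast
    moreover have "(\<Sum>i\<in>I. if z i \<in> H then a i * (z i \<bullet> g (z i)) else K * c i)
        = real (dim H) + K * sum c {i\<in>I. z i \<notin> H}"
      using fin by (simp add: sum.If_cases trace[symmetric] sum_distrib_left Int_def Compl_eq)
    moreover have "sum c I = sum c {i\<in>I. z i \<in> H} + sum c {i\<in>I. z i \<notin> H}"
      using fin by (subst sum.union_disjoint[symmetric]) (auto intro: sum.cong)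
    ultimately show False
      using subspace_mass[OF subH \<open>H \<noteq> UNIV\<close>] K_pos by (simp add: K_def field_simps)
  qed
  have Lpd: "sym_pos_def L"
    unfolding sym_pos_def_def
  proof (intro conjI allI impI L(1))
    fix v :: "real^'p" assume "v \<noteq> 0"
    show "0 < v \<bullet> (L *v v)"
    proof (rule ccontr)
      assume "\<not> 0 < v \<bullet> (L *v v)"
      then have "L *v v = 0" using L(2)[of v] by (intro psd_kernel[OF L(1,2)]) simp
      moreover obtain w where "v = L *v w" using \<open>H = UNIV\<close> by (auto simp: H_def)
      ultimately have "v \<bullet> v = 0" using sym_inner[OF L(1), of v w] by simp
      then show False using \<open>v \<noteq> 0\<close> by simp
    qed
  qed
  \<comment> \<open>On the full range \<open>g\<close> is the inverse of \<open>L\<close>, which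
    turns \<open>L_eq\<close> into the fixed-point equation.\<close>
  have "g x = matrix_inv L *v x" for x
    using pd_inv_mult[OF Lpd, of "g x"] g(2)[of x] \<open>H = UNIV\<close> by simp
  then have "L *v w = scatter_map L *v w" for w
    unfolding L_eq scatter_map_mult using \<open>H = UNIV\<close> by (simp add: a_def dsq_def)
  then have "L = scatter_map L" by (simp add: matrix_eq)
  with Lpd show thesis by (rule that)
qed

end

subsection \<open>Point-mass contamination\<close>

lemma sum_mset_nonneg:
  fixes f :: "'a \<Rightarrow> real"
  shows "(\<And>x. x \<in># M \<Longrightarrow> 0 \<le> f x) \<Longrightarrow> 0 \<le> (\<Sum>x\<in>#M. f x)"
  by (induction M) auto

lemma exists_submultiset_size:
  assumes "k \<le> size M" obtains A where "A \<subseteq># M" "size A = k"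
proof -
  obtain xs where xs: "M = mset xs" using ex_mset by metis
  have "mset (take k xs) \<subseteq># mset xs"
    by (metis append_take_drop_id mset_append mset_subset_eq_add_left)
  then show thesis using that[of "mset (take k xs)"] assms by (simp add: xs)
qed

text \<open>One point too many in \<open>H\<close> could be completed to \<open>p\<close> points
  whose span has dimension at most \<open>dim H + (p - dim H - 1) < p\<close>.\<close>

lemma general_position_subspace_count:
  fixes X :: "(real^'p) multiset"
  assumes gp: "general_position_about t X" and n: "CARD('p) \<le> size X"
    and H: "subspace H" "H \<noteq> UNIV"
  shows "size (filter_mset (\<lambda>x. x - t \<in> H) X) \<le> dim H"
proof (rule ccontr)
  let ?F = "filter_mset (\<lambda>x. x - t \<in> H) X"
  assume "\<not> size ?F \<le> dim H"
  then have "Suc (dim H) \<le> size ?F" by simp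
  then obtain A where A: "A \<subseteq># ?F" "size A = Suc (dim H)" by (rule exists_submultiset_size)
  have AX: "A \<subseteq># X" using A(1) by (meson multiset_filter_subset subset_mset.order_trans)
  have "dim H \<noteq> CARD('p)"
  proof
    assume "dim H = CARD('p)"
    then have "span H = UNIV" using dim_eq_full[of H] by simp
    then show False using H span_eq_iff[of H] by metis
  qed
  then have dimH: "dim H < CARD('p)" using dim_subset_UNIV_cart[of H] by linarith
  have "CARD('p) - Suc (dim H) \<le> size (X - A)" using AX A(2) n by (simp add: size_Diff_submset)
  then obtain B where B: "B \<subseteq># X - A" "size B = CARD('p) - Suc (dim H)"
    by (rule exists_submultiset_size)
  have "A + B \<subseteq># X"
    using AX B(1) by (metis subset_mset.add_diff_inverse subset_mset.add_left_mono)
  moreover have "size (A + B) = CARD('p)" using A(2) B(2) dimH by simp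
  ultimately have sp: "span ((\<lambda>x. x - t) ` set_mset (A + B)) = UNIV"
    using gp unfolding general_position_about_def by blast
  obtain E where E: "E \<subseteq> H" "independent E" "H \<subseteq> span E" "card E = dim H"
    using basis_exists by blast
  have finE: "finite E" using E(2) independent_imp_finite by blast
  let ?W = "E \<union> (\<lambda>x. x - t) ` set_mset B"
  have "(\<lambda>x. x - t) ` set_mset A \<subseteq> H" using A(1) set_mset_mono[OF A(1)] by auto
  then have "(\<lambda>x. x - t) ` set_mset (A + B) \<subseteq> span ?W"
    using E(3) span_mono[of E ?W] span_superset[of ?W] by auto
  then have "span ?W = UNIV"
    using span_minimal[OF _ subspace_span] sp by blast
  then have "dim (UNIV :: (real^'p) set) \<le> card ?W"
    using finE by (intro dim_le_card) auto
  also have "\<dots> \<le> card E + card ((\<lambda>x. x - t) ` set_mset B)" by (rule card_Un_le)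
  also have "\<dots> \<le> dim H + size B"
  proof -
    have "card (set_mset M) \<le> size M" for M :: "(real^'p) multiset"
      by (induction M) (auto simp: card_insert_if)
    then have "card ((\<lambda>x. x - t) ` set_mset B) \<le> size B"
      using card_image_le[of "set_mset B" "\<lambda>x. x - t"] le_trans by blast
    then show ?thesis using E(4) by simp
  qed
  finally show False using B(2) dimH by simp
qed

section \<open>From multisets to weighted families\<close>

lemma sum_mset_eq_sum_count:
  fixes f :: "'a \<Rightarrow> 'b::real_vector"
  shows "(\<Sum>x\<in>#Z. f x) = (\<Sum>x\<in>set_mset Z. real (count Z x) *\<^sub>R f x)"
proof (induction Z)
  case (add x Z)
  have "(\<Sum>y\<in>set_mset (add_mset x Z). real (count (add_mset x Z) y) *\<^sub>R f y)
      = (\<Sum>y\<in>insert x (set_mset Z). real (count Z y) *\<^sub>R f y + (if y = x then f x else 0))"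
    by (auto intro!: sum.cong simp: scaleR_add_left)
  also have "\<dots> = (\<Sum>y\<in>insert x (set_mset Z). real (count Z y) *\<^sub>R f y) + f x"
    by (simp add: sum.distrib)
  also have "(\<Sum>y\<in>insert x (set_mset Z). real (count Z y) *\<^sub>R f y) = (\<Sum>y\<in>set_mset Z. real (count Z y) *\<^sub>R f y)"
    by (rule sum.mono_neutral_right) (auto simp: not_in_iff)
  finally show ?case using add by (simp add: add.commute)
qed simp

lemma sum_count_filter:
  "(\<Sum>x | x \<in># Z \<and> P x. real (count Z x)) = real (size (filter_mset P Z))"
  by (auto simp: size_multiset_overloaded_eq intro!: sum.cong)

text \<open>The distinct points, weighted by relative multiplicity, form a
  \<open>scatter_cloud\<close>, so the definite description denotes its unique fixed point.\<close>

lemma M_scatter_is_M_scatter: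
  fixes Z :: "(real^'p) multiset"
  assumes u: "scatter_weight u" and K: "0 < psi_sup u" and Z: "Z \<noteq> {#}"
    and mass: "\<And>H. subspace H \<Longrightarrow> H \<noteq> UNIV \<Longrightarrow> real (size (filter_mset (\<lambda>x. x - t \<in> H) Z))
      < real (size Z) * (1 - (real CARD('p) - real (dim H)) / psi_sup u)"
  shows "is_M_scatter u t Z (M_scatter u t Z)"
proof -
  define N where "N = real (size Z)"
  have N: "0 < N" using Z by (simp add: N_def nonempty_has_size)
  have total: "(\<Sum>x\<in>set_mset Z. real (count Z x)) = N"
    by (simp add: N_def size_multiset_overloaded_eq)
  interpret scatter_cloud u "set_mset Z" "\<lambda>x. real (count Z x) / N" "\<lambda>x. x - t"
  proof
    show "0 < real (count Z x) / N" if "x \<in># Z" for x using that N by simp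
    show "(\<Sum>x | x \<in># Z \<and> x - t \<in> H. real (count Z x) / N)
        < (\<Sum>x\<in>set_mset Z. real (count Z x) / N) - (real CARD('p) - real (dim H)) / psi_sup u"
      if "subspace H" "H \<noteq> UNIV" for H
      using mass[OF that] N
      by (simp add: sum_count_filter total field_simps flip: sum_divide_distrib N_def)
  qed (use u K in auto)
  have iff: "is_M_scatter u t Z V \<longleftrightarrow> sym_pos_def V \<and> V = scatter_map V" for V
    by (simp add: is_M_scatter_def scatter_map_def sum_mset_eq_sum_count scaleR_sum_right
        sq_dist_def dsq_def flip: N_def)
  have "\<exists>!V. is_M_scatter u t Z V"
    unfolding iff using scatter_fixed_point_exists scatter_fixed_point_le form_le_antisym by metis
  then show ?thesis unfolding M_scatter_def by (rule theI')
qed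

lemma is_M_scatter_form:
  assumes "is_M_scatter u t Z V"
  shows "w \<bullet> (V *v w) = (\<Sum>z\<in>#Z. u (sq_dist t V z) * ((z - t) \<bullet> w)\<^sup>2) / real (size Z)"
proof -
  have "w \<bullet> ((\<Sum>z\<in>#Z. f z *\<^sub>R outer (z - t)) *v w) = (\<Sum>z\<in>#Z. f z * ((z - t) \<bullet> w)\<^sup>2)" for f
    by (induction Z) (simp_all add: matrix_vector_mult_add_rdistrib inner_add_right outer_mult
        power2_eq_square inner_commute flip: scaleR_matrix_vector_assoc)
  moreover have "V *v w = (1 / real (size Z)) *\<^sub>R
      ((\<Sum>z\<in>#Z. u (sq_dist t V z) *\<^sub>R outer (z - t)) *v w)"
    using assms unfolding is_M_scatter_def scaleR_matrix_vector_assoc by metis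
  ultimately show ?thesis by simp
qed

theorem theorem5p1:
  fixes u :: "real \<Rightarrow> real"
    and t \<theta> :: "real ^ 'p"
    and X :: "(real ^ 'p) multiset"
    and n m :: nat
    and K eps :: real
  assumes u: "scatter_weight u"
    and K: "K = psi_sup u" "real CARD('p) < K"
    and X: "size X = n" "general_position_about t X"
    and n: "CARD('p) * (CARD('p) - 1) < n"
    and m: "1 \<le> m"
    and eps: "eps = real m / real (n + m)"
    and \<theta>: "\<theta> \<bullet> \<theta> = 1"
    and nK: "K < real n + 1"
    and lower: "min (1 / K) (1 - real CARD('p) / K) < eps"
    and upper: "eps < min (real CARD('p) / K) (1 - real CARD('p) / K)"
  shows "((\<lambda>r. \<theta> \<bullet> (matrix_inv (M_scatter u t (contaminated t X m \<theta> r)) *v \<theta>)) \<longlongrightarrow> 0) at_infinity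
    \<and> (\<forall>a. (\<nexists>c. a = c *\<^sub>R \<theta>) \<longrightarrow>
          0 < (INF r. a \<bullet> (matrix_inv (M_scatter u t (contaminated t X m \<theta> r)) *v a)))"
proof -
  define N where "N = real (n + m)"
  define Z where "Z = contaminated t X m \<theta>"
  define V where "V r = M_scatter u t (Z r)" for r
  have K0: "0 < psi_sup u" using K of_nat_0_le_iff[of "CARD('p)"] by linarith
  interpret scatter_weight_function u by unfold_locales (use u K0 in auto)
  have N: "0 < N" "K < N" using m nK by (simp_all add: N_def)
  have sizeZ: "real (size (Z r)) = N" for r by (simp add: Z_def contaminated_def X N_def)
  have epsN: "eps * N = real m" using N by (simp add: eps N_def)
  \<comment> \<open>If the lower minimum were \<open>1 - p/K\<close>, it would clash with
    \<open>upper\<close>; so \<open>1/K < eps\<close>.\<close>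
  have epsK: "1 < eps * K" using lower upper K K0 by (auto simp: field_simps min_def split: if_splits)
  \<comment> \<open>For \<open>p \<ge> 2\<close>, \<open>p \<le> p (p - 1) < n\<close>; for
    \<open>p = 1\<close> the hypothesis reads \<open>0 < n\<close>.\<close>
  have p_le_n: "CARD('p) \<le> n"
  proof (cases "CARD('p) = 1")
    case False
    then have "1 \<le> CARD('p) - 1" using zero_less_card_finite[where 'a='p] by linarith
    then have "CARD('p) * 1 \<le> CARD('p) * (CARD('p) - 1)" by (rule mult_le_mono2)
    then show ?thesis using n by linarith
  qed (use n in simp)
  have V: "is_M_scatter u t (Z r) (V r)" for r
    unfolding V_def
  proof (rule M_scatter_is_M_scatter[OF u K0])
    show "Z r \<noteq> {#}" using m by (simp add: Z_def contaminated_def)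
    fix H :: "(real^'p) set" assume H: "subspace H" "H \<noteq> UNIV"
    \<comment> \<open>General position limits the points of \<open>X\<close> in \<open>H\<close>; at
      worst all \<open>m\<close> added copies lie there too.\<close>
    have "size (filter_mset (\<lambda>x. x - t \<in> H) (Z r)) \<le> dim H + m"
      using general_position_subspace_count[OF X(2) _ H] p_le_n X(1)
        size_filter_mset_lesseq[of _ "replicate_mset m (r *\<^sub>R \<theta> + t)"]
      by (simp add: Z_def contaminated_def) (metis add_mono size_replicate_mset)
    then have "real (size (filter_mset (\<lambda>x. x - t \<in> H) (Z r))) \<le> real (dim H) + eps * N"
      using epsN by linarith
    also have "\<dots> < real (dim H) + (1 - real CARD('p) / K) * N"
      using upper N by simp
    \<comment> \<open>Here \<open>K < n + 1 \<le> n + m\<close> enters, through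
      \<open>K < N\<close>.\<close>
    also have "\<dots> \<le> N * (real (dim H) / K) + (1 - real CARD('p) / K) * N"
      using N K K0 mult_right_mono[of K N "real (dim H)"] by (simp add: field_simps)
    also have "\<dots> = N * (1 - (real CARD('p) - real (dim H)) / K)"
      by (simp add: field_simps diff_divide_distrib)
    finally show "real (size (filter_mset (\<lambda>x. x - t \<in> H) (Z r)))
        < real (size (Z r)) * (1 - (real CARD('p) - real (dim H)) / psi_sup u)"
      by (simp add: sizeZ K(1))
  qed
  have pd: "sym_pos_def (V r)" for r using V by (simp add: is_M_scatter_def)
  define s where "s r = sq_dist t (V r) (r *\<^sub>R \<theta> + t)" for r
  have form: "w \<bullet> (V r *v w) = (\<Sum>x\<in>#X. u (sq_dist t (V r) x) * ((x - t) \<bullet> w)\<^sup>2) / N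
      + eps * u (s r) * (r * (\<theta> \<bullet> w))\<^sup>2" for r w
  proof -
    have "(\<Sum>z\<in>#Z r. f z) = (\<Sum>x\<in>#X. f x) + real m * f (r *\<^sub>R \<theta> + t)" for f :: "real^'p \<Rightarrow> real"
      by (simp add: Z_def contaminated_def)
    then show ?thesis
      using is_M_scatter_form[OF V, of w r] N epsN
      by (simp add: sizeZ s_def field_simps)
  qed
  define \<tau> where "\<tau> r = \<theta> \<bullet> (matrix_inv (V r) *v \<theta>)" for r
  have \<theta>0: "\<theta> \<noteq> 0" using \<theta> by auto
  have \<tau>: "0 < \<tau> r" for r unfolding \<tau>_def by (rule pd_inv_pos[OF pd \<theta>0])
  have s: "s r = r\<^sup>2 * \<tau> r" for r
    by (simp add: s_def sq_dist_def \<tau>_def matrix_vector_mult_scaleR power2_eq_square)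
  have term_nonneg: "0 \<le> u (sq_dist t (V r) x) * ((x - t) \<bullet> w)\<^sup>2" for r x w
    using weight_nonneg[OF pd_inv_pos[OF pd, of "x - t" r]]
    by (cases "x - t = 0") (auto simp: sq_dist_def)
  \<comment> \<open>At \<open>g = V^-1 \<theta>\<close> both the form and
    \<open>\<theta> \<bullet> g\<close> equal \<open>\<tau>\<close>; dropping the nonnegative share
    of \<open>X\<close> leaves \<open>eps * psi u s * \<tau> \<le> \<tau>\<close>.\<close>
  have psi_s: "eps * psi u (s r) \<le> 1" for r
  proof -
    define g where "g = matrix_inv (V r) *v \<theta>"
    have "g \<bullet> (V r *v g) = \<tau> r" "\<theta> \<bullet> g = \<tau> r"
      by (simp_all add: g_def \<tau>_def pd_mult_inv[OF pd] inner_commute)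
    moreover have "0 \<le> (\<Sum>x\<in>#X. u (sq_dist t (V r) x) * ((x - t) \<bullet> g)\<^sup>2) / N"
      using N term_nonneg by (intro divide_nonneg_pos sum_mset_nonneg) auto
    ultimately have "eps * u (s r) * (r * \<tau> r)\<^sup>2 \<le> \<tau> r" using form[of g r] by simp
    then have "(eps * psi u (s r)) * \<tau> r \<le> 1 * \<tau> r"
      by (simp add: psi_def s power2_eq_square mult_ac)
    then show ?thesis using \<tau>[of r] by (simp add: mult_le_cancel_right)
  qed
  have eps0: "0 < eps" using eps m by simp
  have "1 / eps < psi_sup u" using epsK K(1) eps0 by (simp add: field_simps)
  \<comment> \<open>\<open>s0\<close> is independent of \<open>r\<close>, and from \<open>s0\<close>
    on the bound \<open>psi_s\<close> would fail.\<close>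
  then obtain s0 where s0: "0 < s0" "1 / eps < psi u s0" by (rule psi_exceeds)
  have s_less: "s r < s0" for r
  proof (rule ccontr)
    assume "\<not> s r < s0"
    then have "psi u s0 \<le> psi u (s r)" using psi_mono[OF s0(1)] by simp
    then have "1 / eps < psi u (s r)" using s0(2) by linarith
    then show False using psi_s[of r] eps0 by (simp add: field_simps)
  qed
  have "(\<tau> \<longlongrightarrow> 0) at_infinity"
  proof (rule tendsto_sandwich[OF _ _ tendsto_const])
    show "\<forall>\<^sub>F r in at_infinity. 0 \<le> \<tau> r" using \<tau> by (simp add: less_imp_le)
    have "\<forall>\<^sub>F r::real in at_infinity. 1 \<le> norm r"
      unfolding eventually_at_infinity by blast
    then show "\<forall>\<^sub>F r in at_infinity. \<tau> r \<le> s0 * (inverse r)\<^sup>2"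
    proof eventually_elim
      case (elim r)
      then have "0 < r\<^sup>2" by auto
      then show ?case using s_less[of r] by (simp add: s field_simps)
    qed
    have "((\<lambda>r::real. s0 * (inverse r)\<^sup>2) \<longlongrightarrow> s0 * 0\<^sup>2) at_infinity"
      by (intro tendsto_intros tendsto_inverse_0)
    then show "((\<lambda>r::real. s0 * (inverse r)\<^sup>2) \<longlongrightarrow> 0) at_infinity" by simp
  qed
  moreover have "0 < (INF r. a \<bullet> (matrix_inv (V r) *v a))" if a: "\<nexists>c. a = c *\<^sub>R \<theta>" for a
  proof -
    \<comment> \<open>The component of \<open>a\<close> orthogonal to \<open>\<theta>\<close>,
      nonzero because \<open>a\<close> is not a multiple of \<open>\<theta>\<close>. The
      contaminating point does not enter the form at \<open>b\<close>.\<close>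
    define b where "b = a - (a \<bullet> \<theta>) *\<^sub>R \<theta>"
    have b\<theta>: "\<theta> \<bullet> b = 0" by (simp add: b_def inner_diff_right \<theta> inner_commute)
    have ba: "b \<bullet> a = b \<bullet> b"
      using b\<theta> by (simp add: b_def inner_diff_right inner_commute)
    have "b \<noteq> 0" using a by (auto simp: b_def)
    then have bb: "0 < b \<bullet> b" by simp
    obtain M where M: "0 < M" "\<And>s. 0 \<le> s \<Longrightarrow> u s \<le> M" using weight_bounded by blast
    \<comment> \<open>A bound, uniform in \<open>r\<close>, for the form of \<open>V r\<close> at
      \<open>b\<close>; the added 1 keeps the later denominator positive.\<close>
    define C where "C = (\<Sum>x\<in>#X. M * ((x - t) \<bullet> b)\<^sup>2) / N + 1"
    have C: "0 < C"
      unfolding C_def using M N by (intro add_nonneg_pos divide_nonneg_pos sum_mset_nonneg) auto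
    have "(b \<bullet> b)\<^sup>2 / C \<le> a \<bullet> (matrix_inv (V r) *v a)" for r
    proof -
      have "(\<Sum>x\<in>#X. u (sq_dist t (V r) x) * ((x - t) \<bullet> b)\<^sup>2) \<le> (\<Sum>x\<in>#X. M * ((x - t) \<bullet> b)\<^sup>2)"
        using M pd_inv_nonneg[OF pd] by (intro sum_mset_mono mult_right_mono) (auto simp: sq_dist_def)
      then have "b \<bullet> (V r *v b) \<le> C"
        using N by (simp add: form b\<theta> C_def divide_right_mono add_increasing2)
      then have "(b \<bullet> b)\<^sup>2 \<le> (a \<bullet> (matrix_inv (V r) *v a)) * C"
        using pd_Cauchy_Schwarz[OF pd, of b a r] mult_left_mono[OF _ pd_inv_nonneg[OF pd, of a r]]
        by (metis ba order_trans)
      then show ?thesis using C by (simp add: divide_le_eq)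
    qed
    then have "(b \<bullet> b)\<^sup>2 / C \<le> (INF r. a \<bullet> (matrix_inv (V r) *v a))"
      by (intro cINF_greatest) auto
    then show ?thesis using bb C by (meson divide_pos_pos less_le_trans zero_less_power)
  qed
  ultimately show ?thesis unfolding \<tau>_def V_def Z_def by blast
qed

end
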